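(* Let $A$ be an o-minimal structure over $\mathbb{R}$ and let $X=\{X_1,\ldots,X_k\}$ be a finite collection of nonempty closed subsets of $\mathbb{R}^n$, definable in $A$, such that $X_i\cap X_j=\emptyset$ for $i\neq j$. Let $x_0\in \mathrm{Conf}_{\mathbb{R}^n}(X)$, let $r_0=\min_i d(x_0,X_i)$, let $S_{x_0,r_0}$ be the sphere of radius $r_0$ centered at $x_0$, and let $\widetilde X=\{\widetilde X_1,\ldots,\widetilde X_k\}$ be the collection of sets $\widetilde X_i=X_i\cap S_{x_0,r_0}$. Then: (1) $T_{x_0}\big(\mathrm{Ter}_{\mathbb{R}^n}(X_i,X)\big)=C_{x_0}\big(\mathrm{Ter}_{S_{x_0,r_0}}(\widetilde X_i,\widetilde X)\big)$ for every $i$; (2) $T_{x_0}\big(\mathrm{Conf}_{\mathbb{R}^n}(X)\big)=C_{x_0}\big(\mathrm{Conf}_{S_{x_0,r_0}}(\widetilde X)\big)$.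
   Context: For a metric space $(M,d)$ and a finite collection $X=\{X_1,\ldots,X_k\}$ of closed pairwise disjoint subsets of $M$, the territory of $X_i$ is $\mathrm{Ter}_M(X_i,X)=\{x\in M : d(x,X_i)\le d(x,X_j)\text{ for all } j\}$, and the conflict set is $\mathrm{Conf}_M(X)=\{x\in M : x\in \mathrm{Ter}_M(X_i,X)\cap \mathrm{Ter}_M(X_j,X)\text{ for some } i\neq j\}$, where $d(x,B)=\inf_{b\in B}d(x,b)$. Some of the $\widetilde X_i$ may be empty; the convention is $d(x,\emptyset)=+\infty$, and the members with $\widetilde X_i=\emptyset$ have empty territory and do not contribute to the conflict set of $\widetilde X$. $\mathbb{R}^n$ carries the Euclidean metric and $S_{x_0,r_0}$ carries its standard geodesic metric. The o-minimal structure is assumed to expand the real field. For $M\subset\mathbb{R}^n$, the cone $C_{x_0}M$ is the union of all rays starting at $x_0$ and passing through points $y\in M$, $y\ne x_0$; the vertex $x_0$ is always included, so $C_{x_0}\emptyset=\{x_0\}$. For a definable set $Y\subset\mathbb{R}^n$, the tangent cone at $x_0$, regarded as a subset of $\mathbb{R}^n$ with vertex $x_0$, is $T_{x_0}Y=C_{x_0}\big(\lim_{\varepsilon\to 0^+}N_\varepsilon(Y)\big)$, where $N_\varepsilon(Y)=\frac{1}{\varepsilon}\big[(Y\cap S_{x_0,\varepsilon})-x_0\big]+x_0$, $S_{x_0,\varepsilon}$ is the sphere of radius $\varepsilon$ centered at $x_0$, and the limit is the Hausdorff limit (the limit of empty sets being empty). Equivalently, when $x_0\in Y$, $T_{x_0}Y$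 is $x_0$ plus the set of all one-sided tangent vectors at $t=0$ of definable arcs $\gamma:[0,\varepsilon)\to Y$ with $\gamma(0)=x_0$. *)

theory Defs
  imports "HOL-Analysis.Analysis"
begin

section \<open>O-minimal structures expanding the real field\<close>

text \<open>
  \<open>A m\<close> is the collection of definable subsets of \<open>\<real>\<^sup>m\<close>, whose points are lists of
  length \<open>m\<close>. The axioms are those of van den Dries, with the graphs of addition and
  multiplication definable. As \<open>o_minimal\<close> is an equivalence, all singletons are definable, i.e.
  parameters are allowed; \<open>is_interval\<close> holds exactly of the empty set, points, and bounded or
  unbounded intervals of all kinds.
\<close>

locale o_minimal_structure =
  fixes A :: "nat \<Rightarrow> real list set set"
  assumes dim: "\<And>m S. S \<in> A m \<Longrightarrow> S \<subseteq> {x. length x = m}"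
    and empty: "\<And>m. {} \<in> A m"
    and union: "\<And>m S T. S \<in> A m \<Longrightarrow> T \<in> A m \<Longrightarrow> S \<union> T \<in> A m"
    and complement: "\<And>m S. S \<in> A m \<Longrightarrow> {x. length x = m} - S \<in> A m"
    and times_left: "\<And>m S. S \<in> A m \<Longrightarrow> {t # x | t x. x \<in> S} \<in> A (Suc m)"
    and times_right: "\<And>m S. S \<in> A m \<Longrightarrow> {x @ [t] | t x. x \<in> S} \<in> A (Suc m)"
    and diagonal: "\<And>m. 1 \<le> m \<Longrightarrow> {x. length x = m \<and> hd x = last x} \<in> A m"
    and projection: "\<And>m S. S \<in> A (Suc m) \<Longrightarrow> butlast ` S \<in> A m"
    and order: "{[x, y] | x y. x < y} \<in> A 2"
    and o_minimal: "\<And>S. S \<in> A 1 \<longleftrightarrow>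
          (\<exists>\<I>. finite \<I> \<and> (\<forall>I\<in>\<I>. is_interval I) \<and> S = (\<lambda>t. [t]) ` \<Union>\<I>)"
    and addition: "{[x, y, x + y] | x y. True} \<in> A 3"
    and multiplication: "{[x, y, x * y] | x y. True} \<in> A 3"

text \<open>
  The coordinates of \<open>real ^ 'n\<close> are listed in the order given by a bijection \<open>e\<close>. The
  choice is immaterial since structures are closed under permutation of coordinates.
\<close>

definition definable :: "(nat \<Rightarrow> real list set set) \<Rightarrow> (real ^ 'n) set \<Rightarrow> bool" where
  "definable A Y \<longleftrightarrow> (\<exists>e :: nat \<Rightarrow> 'n. bij_betw e {..<CARD('n)} UNIV \<and>
     (\<lambda>y. map (\<lambda>i. y $ e i) [0..<CARD('n)]) ` Y \<in> A CARD('n))"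


section \<open>Territories and conflict sets\<close>

text \<open>The distance takes values in \<open>ennreal\<close>, where the infimum over the empty set is \<open>\<infinity>\<close>.\<close>

definition mdist_set :: "'a metric \<Rightarrow> 'a \<Rightarrow> 'a set \<Rightarrow> ennreal" where
  "mdist_set m x B = (INF b\<in>B. ennreal (mdist m x b))"

lemma mdist_set_empty [simp]: "mdist_set m x {} = \<infinity>"
  by (simp add: mdist_set_def)

lemma mdist_set_less_iff: "mdist_set m x B < c \<longleftrightarrow> (\<exists>b\<in>B. ennreal (mdist m x b) < c)"
  by (simp add: mdist_set_def INF_less_iff)

lemma mdist_set_euclidean: "B \<noteq> {} \<Longrightarrow> mdist_set euclidean_metric x B = ennreal (infdist x B)"
proof (rule antisym)
  assume B: "B \<noteq> {}"
  show "ennreal (infdist x B) \<le> mdist_set euclidean_metric x B"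
    unfolding mdist_set_def by (auto intro!: INF_greatest ennreal_leI infdist_le)
  show "mdist_set euclidean_metric x B \<le> ennreal (infdist x B)"
  proof (rule ennreal_le_epsilon)
    fix e :: real assume "0 < e"
    then obtain b where b: "b \<in> B" "dist x b < infdist x B + e"
      using B cINF_less_iff[of B "\<lambda>b. dist x b" "infdist x B + e"]
      by (auto simp: infdist_def intro: bdd_belowI2[of _ 0])
    have "mdist_set euclidean_metric x B \<le> ennreal (dist x b)"
      unfolding mdist_set_def using b by (intro INF_lower2[of b]) auto
    also have "\<dots> \<le> ennreal (infdist x B + e)"
      using b by (intro ennreal_leI) auto
    finally show "mdist_set euclidean_metric x B \<le> ennreal (infdist x B) + ennreal e"
      using \<open>0 < e\<close> by (simp add: ennreal_plus infdist_nonneg)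
  qed
qed

text \<open>
  Empty members have empty territory, by convention also when all members of the collection
  are empty.
\<close>

definition territory :: "'a metric \<Rightarrow> nat \<Rightarrow> (nat \<Rightarrow> 'a set) \<Rightarrow> nat \<Rightarrow> 'a set" where
  "territory m k X i = {x \<in> mspace m. X i \<noteq> {} \<and>
     (\<forall>j\<in>{1..k}. mdist_set m x (X i) \<le> mdist_set m x (X j))}"

definition conflict_set :: "'a metric \<Rightarrow> nat \<Rightarrow> (nat \<Rightarrow> 'a set) \<Rightarrow> 'a set" where
  "conflict_set m k X = {x \<in> mspace m. \<exists>i\<in>{1..k}. \<exists>j\<in>{1..k}. i \<noteq> j \<and>
     x \<in> territory m k X i \<inter> territory m k X j}"


section \<open>The geodesic metric of a round sphere\<close>

text \<open>
  Great-circle distance: the radius times the angle, in \<open>[0, \<pi>]\<close>, between the two radius vectors.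
\<close>

definition sphere_dist :: "'a::real_inner \<Rightarrow> real \<Rightarrow> 'a \<Rightarrow> 'a \<Rightarrow> real" where
  "sphere_dist x0 r u v = r * arccos (sgn (u - x0) \<bullet> sgn (v - x0))"

definition sphere_metric :: "'a::real_inner \<Rightarrow> real \<Rightarrow> 'a metric" where
  "sphere_metric x0 r = metric (sphere x0 r, sphere_dist x0 r)"

lemma abs_inner_sgn_le_1: "\<bar>sgn x \<bullet> sgn y\<bar> \<le> 1" for x y :: "'a::real_inner"
proof -
  have "\<bar>sgn x \<bullet> sgn y\<bar> \<le> norm (sgn x) * norm (sgn y)"
    by (rule Cauchy_Schwarz_ineq2)
  also have "\<dots> \<le> 1"
    by (simp add: norm_sgn)
  finally show ?thesis .
qed

lemma arccos_inner_triangle: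
  fixes a b c :: "'a::real_inner"
  assumes "norm a = 1" "norm b = 1" "norm c = 1"
  shows "arccos (a \<bullet> c) \<le> arccos (a \<bullet> b) + arccos (b \<bullet> c)"
proof -
  have le: "\<bar>x \<bullet> y\<bar> \<le> 1" if "norm x = 1" "norm y = 1" for x y :: 'a
    using Cauchy_Schwarz_ineq2[of x y] that by simp
  have sq: "x \<bullet> x = 1" if "norm x = 1" for x :: 'a
    using that by (simp add: dot_square_norm)
  define p where "p = arccos (a \<bullet> b)"
  define q where "q = arccos (b \<bullet> c)"
  have p: "0 \<le> p" "p \<le> pi" "cos p = a \<bullet> b" "sin p = sqrt (1 - (a \<bullet> b)\<^sup>2)"
    using le[of a b] assms unfolding p_def
    by (auto simp: abs_le_iff intro!: arccos_lbound arccos_ubound sin_arccos_abs cos_arccos)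
  have q: "0 \<le> q" "q \<le> pi" "cos q = b \<bullet> c" "sin q = sqrt (1 - (b \<bullet> c)\<^sup>2)"
    using le[of b c] assms unfolding q_def
    by (auto simp: abs_le_iff intro!: arccos_lbound arccos_ubound sin_arccos_abs cos_arccos)
  show ?thesis
  proof (cases "p + q \<le> pi")
    case False
    moreover have "arccos (a \<bullet> c) \<le> pi"
      using le[of a c] assms by (intro arccos_ubound) auto
    ultimately show ?thesis by (simp add: p_def q_def)
  next
    case True
    define a' where "a' = a - (a \<bullet> b) *\<^sub>R b"
    define c' where "c' = c - (b \<bullet> c) *\<^sub>R b"
    have "a' \<bullet> a' = 1 - (a \<bullet> b)\<^sup>2" "c' \<bullet> c' = 1 - (b \<bullet> c)\<^sup>2"
      using assms by (simp_all add: a'_def c'_def inner_diff_left inner_diff_right sq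
          inner_commute power2_eq_square)
    then have "norm a' = sin p" "norm c' = sin q"
      by (simp_all add: norm_eq_sqrt_inner p q)
    moreover have "a' \<bullet> c' = a \<bullet> c - (a \<bullet> b) * (b \<bullet> c)"
      using assms by (simp add: a'_def c'_def inner_diff_left inner_diff_right sq
          inner_commute)
    ultimately have "cos (p + q) \<le> a \<bullet> c"
      using Cauchy_Schwarz_ineq2[of a' c'] by (simp add: cos_add p q)
    then have "arccos (a \<bullet> c) \<le> arccos (cos (p + q))"
      using le[of a c] assms by (intro arccos_le_arccos) auto
    also have "\<dots> = p + q"
      using True p q by (intro arccos_cos) auto
    finally show ?thesis by (simp add: p_def q_def)
  qed
qed

lemma Metric_space_sphere:
  assumes "0 \<le> r"
  shows "Metric_space (sphere x0 r) (sphere_dist x0 r)"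
proof
  fix x y z
  show "0 \<le> sphere_dist x0 r x y"
    using assms abs_inner_sgn_le_1[of "x - x0" "y - x0"]
    by (auto simp: sphere_dist_def abs_le_iff intro!: mult_nonneg_nonneg arccos_lbound)
  show "sphere_dist x0 r x y = sphere_dist x0 r y x"
    by (simp add: sphere_dist_def inner_commute)
  assume x: "x \<in> sphere x0 r" and y: "y \<in> sphere x0 r"
  show "sphere_dist x0 r x y = 0 \<longleftrightarrow> x = y"
  proof (cases "r = 0")
    case True
    with x y show ?thesis by (auto simp: sphere_dist_def)
  next
    case False
    with x y have n: "norm (sgn (x - x0)) = 1" "norm (sgn (y - x0)) = 1"
      and s: "sgn (x - x0) = (x - x0) /\<^sub>R r" "sgn (y - x0) = (y - x0) /\<^sub>R r"
      by (auto simp: norm_sgn sgn_div_norm dist_norm norm_minus_commute)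
    have "sphere_dist x0 r x y = 0 \<longleftrightarrow> sgn (x - x0) \<bullet> sgn (y - x0) = 1"
      using False abs_inner_sgn_le_1[of "x - x0" "y - x0"]
      by (simp add: sphere_dist_def arccos_eq_0_iff abs_le_iff)
    also have "\<dots> \<longleftrightarrow> sgn (x - x0) = sgn (y - x0)"
      using n norm_cauchy_schwarz_eq[of "sgn (x - x0)" "sgn (y - x0)"] by auto
    also have "\<dots> \<longleftrightarrow> x = y"
      using False by (simp add: s)
    finally show ?thesis .
  qed
  assume z: "z \<in> sphere x0 r"
  show "sphere_dist x0 r x z \<le> sphere_dist x0 r x y + sphere_dist x0 r y z"
  proof (cases "r = 0")
    case False
    with x y z have "norm (sgn (x - x0)) = 1" "norm (sgn (y - x0)) = 1" "norm (sgn (z - x0)) = 1"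
      by (auto simp: norm_sgn)
    from arccos_inner_triangle[OF this] assms show ?thesis
      by (simp add: sphere_dist_def mult_left_mono flip: distrib_left)
  qed (simp add: sphere_dist_def)
qed

lemma mspace_sphere_metric [simp]: "0 \<le> r \<Longrightarrow> mspace (sphere_metric x0 r) = sphere x0 r"
  by (simp add: sphere_metric_def Metric_space.mspace_metric[OF Metric_space_sphere])

lemma mdist_sphere_metric [simp]: "0 \<le> r \<Longrightarrow> mdist (sphere_metric x0 r) = sphere_dist x0 r"
  by (simp add: sphere_metric_def Metric_space.mdist_metric[OF Metric_space_sphere])


section \<open>Hausdorff limits and tangent cones\<close>

text \<open>
  Limits are required to be closed, which makes them unique.
  In \<open>ennreal\<close> the supremum over the empty set is \<open>0\<close>, so the empty set has distance \<open>0\<close> from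
  itself and \<open>\<infinity>\<close> from every nonempty set.
\<close>

definition hausdorff_dist :: "'a::metric_space set \<Rightarrow> 'a set \<Rightarrow> ennreal" where
  "hausdorff_dist S T = sup (SUP s\<in>S. mdist_set euclidean_metric s T)
                            (SUP t\<in>T. mdist_set euclidean_metric t S)"

definition hausdorff_tendsto ::
    "('b \<Rightarrow> 'a::metric_space set) \<Rightarrow> 'a set \<Rightarrow> 'b filter \<Rightarrow> bool" where
  "hausdorff_tendsto F L G \<longleftrightarrow> closed L \<and> ((\<lambda>t. hausdorff_dist (F t) L) \<longlongrightarrow> 0) G"

definition hausdorff_lim :: "'b filter \<Rightarrow> ('b \<Rightarrow> 'a::metric_space set) \<Rightarrow> 'a set" where
  "hausdorff_lim G F = (THE L. hausdorff_tendsto F L G)"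

lemma hausdorff_dist_lessD:
  assumes "hausdorff_dist S T < ennreal e"
  shows "s \<in> S \<Longrightarrow> \<exists>t\<in>T. dist s t < e" and "t \<in> T \<Longrightarrow> \<exists>s\<in>S. dist t s < e"
proof -
  have less: "\<exists>b\<in>B. dist x b < e" if "mdist_set euclidean_metric x B < ennreal e" for x B
    using that by (auto simp: mdist_set_less_iff ennreal_less_iff)
  show "\<exists>t\<in>T. dist s t < e" if "s \<in> S"
  proof (rule less)
    have "mdist_set euclidean_metric s T \<le> hausdorff_dist S T"
      unfolding hausdorff_dist_def using that by (intro le_supI1 SUP_upper)
    then show "mdist_set euclidean_metric s T < ennreal e"
      using assms by (rule le_less_trans)
  qed
  show "\<exists>s\<in>S. dist t s < e" if "t \<in> T"
  proof (rule less)
    have "mdist_set euclidean_metric t S \<le> hausdorff_dist S T"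
      unfolding hausdorff_dist_def using that by (intro le_supI2 SUP_upper)
    then show "mdist_set euclidean_metric t S < ennreal e"
      using assms by (rule le_less_trans)
  qed
qed

lemma hausdorff_tendsto_subset:
  assumes "G \<noteq> bot" "hausdorff_tendsto F L G" "hausdorff_tendsto F L' G"
  shows "L \<subseteq> L'"
proof
  fix x assume x: "x \<in> L"
  have "\<exists>y\<in>L'. dist y x < e" if "0 < e" for e
  proof -
    have "0 < ennreal (e / 2)"
      using that by simp
    then have "\<forall>\<^sub>F t in G. hausdorff_dist (F t) L < ennreal (e / 2)"
      and "\<forall>\<^sub>F t in G. hausdorff_dist (F t) L' < ennreal (e / 2)"
      using assms(2,3) order_tendstoD(2) unfolding hausdorff_tendsto_def by blast+
    then have "\<forall>\<^sub>F t in G. hausdorff_dist (F t) L < ennreal (e / 2) \<and>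
        hausdorff_dist (F t) L' < ennreal (e / 2)"
      by (rule eventually_conj)
    then obtain t where t: "hausdorff_dist (F t) L < ennreal (e / 2)"
        "hausdorff_dist (F t) L' < ennreal (e / 2)"
      using assms(1) eventually_happens' by blast
    obtain s where s: "s \<in> F t" "dist x s < e / 2"
      using hausdorff_dist_lessD(2)[OF t(1) x] by blast
    obtain y where "y \<in> L'" "dist s y < e / 2"
      using hausdorff_dist_lessD(1)[OF t(2) s(1)] by blast
    with s have "dist y x < e"
      using dist_triangle[of x y s] by (simp add: dist_commute)
    with \<open>y \<in> L'\<close> show ?thesis by blast
  qed
  then have "x \<in> closure L'"
    by (simp add: closure_approachable)
  then show "x \<in> L'"
    using assms(3) by (simp add: hausdorff_tendsto_def)
qed

lemma hausdorff_lim_eqI: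
  assumes "G \<noteq> bot" "hausdorff_tendsto F L G"
  shows "hausdorff_lim G F = L"
  unfolding hausdorff_lim_def
  using assms by (intro the_equality) (auto dest: hausdorff_tendsto_subset)

definition cone_from :: "'a::real_vector \<Rightarrow> 'a set \<Rightarrow> 'a set" where
  "cone_from x0 M = insert x0 {x0 + t *\<^sub>R (y - x0) | t y. 0 \<le> t \<and> y \<in> M \<and> y \<noteq> x0}"

definition link_rescaled :: "'a::real_normed_vector \<Rightarrow> 'a set \<Rightarrow> real \<Rightarrow> 'a set" where
  "link_rescaled x0 Y \<epsilon> = (\<lambda>y. (1 / \<epsilon>) *\<^sub>R (y - x0) + x0) ` (Y \<inter> sphere x0 \<epsilon>)"

definition tangent_cone :: "'a::real_normed_vector \<Rightarrow> 'a set \<Rightarrow> 'a set" where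
  "tangent_cone x0 Y = cone_from x0 (hausdorff_lim (at_right 0) (link_rescaled x0 Y))"

end

theory Submission
  imports Defs
begin

text \<open>
  For closed sets the distance from \<open>x0 + t u\<close> to \<open>X i\<close> is, to first order in \<open>t\<close>, governed by the
  largest inner product \<open>u \<bullet> (p - x0)\<close> over the contact points \<open>p \<in> X i \<inter> sphere x0 r0\<close>, which is
  also what the geodesic distance on the sphere measures. Hence limits of directions in a territory
  lie in the corresponding spherical territory. Conversely a direction of a spherical territory,
  tilted slightly towards its contact point, lies strictly inside it, so that the ray it spans
  starts in the Euclidean territory. For conflict directions, two such tilts are joined by a
  short arc in each small sphere around \<open>x0\<close>; being connected and covered by the closed
  territories, the arc meets the conflict set.
\<close>

section \<open>Hausdorff convergence and tangent cones\<close>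

text \<open>Compactness of \<open>K\<close> makes two pointwise conditions uniform: finitely many
  neighbourhoods cover the part of \<open>K\<close> away from \<open>L\<close>, and a finite net
  approximates \<open>L\<close>. For empty \<open>L\<close>, \<open>outer\<close> makes
  \<open>F t\<close> eventually empty.\<close>

lemma hausdorff_tendsto_compactI:
  fixes L K :: "'a::metric_space set"
  assumes G: "G \<noteq> bot" and K: "compact K" "L \<subseteq> K" "\<And>t. F t \<subseteq> K"
    and outer: "\<And>x. x \<in> K - L \<Longrightarrow> \<forall>\<^sub>F (t, y) in G \<times>\<^sub>F nhds x. y \<notin> F t"
    and inner: "\<And>x e. x \<in> L \<Longrightarrow> 0 < e \<Longrightarrow> \<forall>\<^sub>F t in G. \<exists>y\<in>F t. dist x y < e"
  shows "hausdorff_tendsto F L G"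
proof -
  \<comment> \<open>A limit point of \<open>L\<close> outside \<open>L\<close> would, by
    \<open>outer\<close>, have a neighbourhood eventually missed by \<open>F t\<close>; but this
    neighbourhood contains points of \<open>L\<close>, which \<open>inner\<close> approximates by
    points of \<open>F t\<close>.\<close>
  have "closed L"
  proof -
    have "x \<in> L" if x: "x \<in> closure L" for x
    proof (rule ccontr)
      assume "x \<notin> L"
      moreover have "x \<in> K"
        using x K closure_minimal[of L K] compact_imp_closed by blast
      ultimately obtain P Q where P: "eventually P G" and Q: "eventually Q (nhds x)"
        and PQ: "\<And>t y. P t \<Longrightarrow> Q y \<Longrightarrow> y \<notin> F t"
        using outer[of x] unfolding eventually_prod_filter by auto
      obtain d where d: "0 < d" "\<And>y. dist y x < d \<Longrightarrow> Q y"
        using Q unfolding eventually_nhds_metric by blast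
      obtain z where z: "z \<in> L" "dist z x < d / 2"
        using x d(1) closure_approachable[of x L] half_gt_zero by blast
      have "\<forall>\<^sub>F t in G. P t \<and> (\<exists>y\<in>F t. dist z y < d / 2)"
        using P inner[OF z(1), of "d / 2"] d(1) by (intro eventually_conj) auto
      then obtain t y where "P t" "y \<in> F t" "dist z y < d / 2"
        using eventually_happens'[OF G] by blast
      moreover have "dist y x < d"
        using dist_triangle[of y x z] z(2) \<open>dist z y < d / 2\<close> by (simp add: dist_commute)
      ultimately show False
        using PQ d(2) by blast
    qed
    then show ?thesis
      using closure_subset_eq by blast
  qed
  have "\<forall>\<^sub>F t in G. hausdorff_dist (F t) L < a" if "0 < a" for a
  proof -
    \<comment> \<open>\<open>a\<close> may be infinite, so density first supplies a finite positive
      value below it.\<close>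
    obtain e :: real where e: "0 < e" "ennreal e < a"
    proof -
      obtain b where b: "0 < b" "b < a"
        using dense[OF \<open>0 < a\<close>] by blast
      then have "b < top"
        using less_le_trans top_greatest by blast
      then have "b = ennreal (enn2real b)"
        by simp
      with b \<open>b < top\<close> show thesis
        by (intro that[of "enn2real b"]) (auto simp: enn2real_positive_iff)
    qed
    have cover1: "\<forall>\<^sub>F t in G. \<forall>y\<in>F t. \<exists>x\<in>L. dist y x < e"
    proof -
      define C where "C = K - (\<Union>x\<in>L. ball x e)"
      have C: "compact C"
        unfolding C_def using K(1) by (intro compact_diff) auto
      have "\<exists>P U. eventually P G \<and> open U \<and> x \<in> U \<and> (\<forall>t y. P t \<longrightarrow> y \<in> U \<longrightarrow> y \<notin> F t)"
        if "x \<in> C" for x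
      proof -
        have "x \<in> K - L"
          using that e(1) unfolding C_def by force
        then obtain P Q where "eventually P G" "eventually Q (nhds x)"
            "\<And>t y. P t \<Longrightarrow> Q y \<Longrightarrow> y \<notin> F t"
          using outer[of x] unfolding eventually_prod_filter by auto
        then show ?thesis
          unfolding eventually_nhds by blast
      qed
      then obtain P U where PU: "\<And>x. x \<in> C \<Longrightarrow> eventually (P x) G" "\<And>x. x \<in> C \<Longrightarrow> open (U x)"
          "\<And>x. x \<in> C \<Longrightarrow> x \<in> U x" "\<And>x t y. x \<in> C \<Longrightarrow> P x t \<Longrightarrow> y \<in> U x \<Longrightarrow> y \<notin> F t"
        by metis
      obtain B where B: "B \<subseteq> C" "finite B" "C \<subseteq> (\<Union>x\<in>B. U x)"
        using compactE_image[OF C, of C U] PU(2,3) by blast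
      have "\<forall>\<^sub>F t in G. \<forall>x\<in>B. P x t"
        using B PU(1) by (intro eventually_ball_finite) auto
      then show ?thesis
      proof eventually_elim
        case (elim t)
        show ?case
        proof
          fix y assume y: "y \<in> F t"
          then have "y \<notin> C"
            using elim B PU(4) by blast
          then show "\<exists>x\<in>L. dist y x < e"
            using y K(3) unfolding C_def by (auto simp: dist_commute)
        qed
      qed
    qed
    have cover2: "\<forall>\<^sub>F t in G. \<forall>x\<in>L. \<exists>y\<in>F t. dist x y < e"
    proof -
      have "compact L"
        using K \<open>closed L\<close> closed_Int_compact[of L K] by (simp add: Int_absorb2)
      then obtain B where B: "B \<subseteq> L" "finite B" "L \<subseteq> (\<Union>x\<in>B. ball x (e / 2))"
        using compactE_image[of L L "\<lambda>x. ball x (e / 2)"] e(1) by force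
      have "\<forall>\<^sub>F t in G. \<forall>x\<in>B. \<exists>y\<in>F t. dist x y < e / 2"
        using B e(1) inner[of _ "e / 2"] half_gt_zero[OF e(1)] by (intro eventually_ball_finite) blast+
      then show ?thesis
      proof eventually_elim
        case (elim t)
        show ?case
        proof
          fix x assume "x \<in> L"
          then obtain b where b: "b \<in> B" "dist b x < e / 2"
            using B by auto
          with elim obtain y where y: "y \<in> F t" "dist b y < e / 2"
            by blast
          have "dist x y < e"
            using dist_triangle[of x y b] b y by (simp add: dist_commute)
          with y show "\<exists>y\<in>F t. dist x y < e" by blast
        qed
      qed
    qed
    have le: "mdist_set euclidean_metric x B \<le> ennreal e" if "\<exists>y\<in>B. dist x y < e" for x and B :: "'a set"
      using that unfolding mdist_set_def by (auto intro!: INF_lower2 ennreal_leI)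
    show ?thesis
      using cover1 cover2
    proof eventually_elim
      case (elim t)
      have "hausdorff_dist (F t) L \<le> ennreal e"
        unfolding hausdorff_dist_def using elim le by (intro sup_least SUP_least) auto
      then show ?case
        using e(2) by (rule le_less_trans)
    qed
  qed
  then show ?thesis
    unfolding hausdorff_tendsto_def using \<open>closed L\<close> by (auto intro: order_tendstoI)
qed

text \<open>Existence of the Hausdorff limit is part of the claim. Hence \<open>inner\<close> asks
  for approximation at all small radii, not just along a sequence, and the product filter in
  \<open>outer\<close> lets radius and direction vary together.\<close>

lemma tangent_cone_eqI:
  fixes x0 :: "'a::euclidean_space"
  assumes outer: "\<And>u. norm u = 1 \<Longrightarrow> u \<notin> D \<Longrightarrow>
      \<forall>\<^sub>F (t, s) in at_right 0 \<times>\<^sub>F nhds u. x0 + t *\<^sub>R s \<notin> Y"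
    and inner: "\<And>u e. norm u = 1 \<Longrightarrow> u \<in> D \<Longrightarrow> 0 < e \<Longrightarrow>
      \<forall>\<^sub>F t in at_right 0. \<exists>s. norm s = 1 \<and> dist u s < e \<and> x0 + t *\<^sub>R s \<in> Y"
  shows "tangent_cone x0 Y = cone_from x0 {x \<in> sphere x0 1. x - x0 \<in> D}"
proof -
  define L where "L = {x \<in> sphere x0 1. x - x0 \<in> D}"
  have link: "x \<in> link_rescaled x0 Y t \<longleftrightarrow> norm (x - x0) = 1 \<and> x0 + t *\<^sub>R (x - x0) \<in> Y"
    if "0 < t" for x t
  proof
    assume "x \<in> link_rescaled x0 Y t"
    then show "norm (x - x0) = 1 \<and> x0 + t *\<^sub>R (x - x0) \<in> Y"
      using that by (auto simp: link_rescaled_def dist_norm norm_minus_commute)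
  next
    assume "norm (x - x0) = 1 \<and> x0 + t *\<^sub>R (x - x0) \<in> Y"
    then show "x \<in> link_rescaled x0 Y t"
      unfolding link_rescaled_def using that
      by (intro image_eqI[of _ _ "x0 + t *\<^sub>R (x - x0)"]) (auto simp: dist_norm)
  qed
  \<comment> \<open>The criterion wants every set inside \<open>K\<close>, but at radius 0 the
    rescaled link may be \<open>{x0}\<close>, which is off the unit sphere. The filter
    \<open>at_right 0\<close> does not see the change.\<close>
  let ?F = "\<lambda>t. if 0 < t then link_rescaled x0 Y t else {}"
  have pos: "\<forall>\<^sub>F t in at_right (0::real). 0 < t"
    by (rule eventually_at_right_less)
  have "hausdorff_tendsto ?F L (at_right 0)"
  proof (rule hausdorff_tendsto_compactI[where K = "sphere x0 1"])
    show "L \<subseteq> sphere x0 1" "\<And>t. ?F t \<subseteq> sphere x0 1"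
      by (auto simp: L_def link dist_norm norm_minus_commute)
  next
    fix x assume "x \<in> sphere x0 1 - L"
    then have "\<forall>\<^sub>F (t, s) in at_right 0 \<times>\<^sub>F nhds (x - x0). x0 + t *\<^sub>R s \<notin> Y"
      by (intro outer) (auto simp: L_def dist_norm norm_minus_commute)
    moreover have "filterlim (\<lambda>(t, y). (t, y - x0)) (at_right 0 \<times>\<^sub>F nhds (x - x0))
        (at_right 0 \<times>\<^sub>F nhds x)"
      unfolding case_prod_unfold
      by (intro filterlim_Pair filterlim_fst tendsto_diff tendsto_const filterlim_snd)
    ultimately have "\<forall>\<^sub>F (t, y) in at_right 0 \<times>\<^sub>F nhds x. x0 + t *\<^sub>R (y - x0) \<notin> Y"
      unfolding filterlim_iff case_prod_unfold by fastforce
    then show "\<forall>\<^sub>F (t, y) in at_right 0 \<times>\<^sub>F nhds x. y \<notin> ?F t"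
      by (rule eventually_mono) (auto simp: link split: if_splits)
  next
    fix x and e :: real assume x: "x \<in> L" and "0 < e"
    then have "\<forall>\<^sub>F t in at_right 0. \<exists>s. norm s = 1 \<and> dist (x - x0) s < e \<and> x0 + t *\<^sub>R s \<in> Y"
      by (intro inner) (auto simp: L_def dist_norm norm_minus_commute)
    with pos show "\<forall>\<^sub>F t in at_right 0. \<exists>y\<in>?F t. dist x y < e"
    proof eventually_elim
      case (elim t)
      then obtain s where "norm s = 1" "dist (x - x0) s < e" "x0 + t *\<^sub>R s \<in> Y"
        by blast
      with elim(1) show ?case
        by (intro bexI[of _ "x0 + s"]) (auto simp: link dist_norm algebra_simps)
    qed
  qed auto
  moreover have "\<forall>\<^sub>F t in at_right 0. hausdorff_dist (?F t) L = hausdorff_dist (link_rescaled x0 Y t) L"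
    using pos by eventually_elim simp
  ultimately have "hausdorff_tendsto (link_rescaled x0 Y) L (at_right 0)"
    unfolding hausdorff_tendsto_def by (simp only: tendsto_cong)
  then have "hausdorff_lim (at_right 0) (link_rescaled x0 Y) = L"
    by (intro hausdorff_lim_eqI) auto
  then show ?thesis
    by (simp add: tangent_cone_def L_def)
qed

section \<open>Cones over spheres and angles between radius vectors\<close>

lemma cone_from_sphere_subset:
  fixes x0 :: "'a::real_normed_vector"
  assumes "0 < r" "0 < r'" and D: "\<And>u c. u \<in> D \<Longrightarrow> 0 < c \<Longrightarrow> c *\<^sub>R u \<in> D"
  shows "cone_from x0 {x \<in> sphere x0 r. x - x0 \<in> D} \<subseteq> cone_from x0 {x \<in> sphere x0 r'. x - x0 \<in> D}"
proof
  fix z assume "z \<in> cone_from x0 {x \<in> sphere x0 r. x - x0 \<in> D}"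
  then consider "z = x0"
    | t y where "0 \<le> t" "dist x0 y = r" "y - x0 \<in> D" "z = x0 + t *\<^sub>R (y - x0)"
    by (auto simp: cone_from_def)
  then show "z \<in> cone_from x0 {x \<in> sphere x0 r'. x - x0 \<in> D}"
  proof cases
    case 2
    define y' where "y' = x0 + (r' / r) *\<^sub>R (y - x0)"
    have "z = x0 + (t * r / r') *\<^sub>R (y' - x0)"
      using 2 assms by (simp add: y'_def)
    moreover have "dist x0 y' = r'"
      using 2 assms by (simp add: y'_def dist_norm norm_minus_commute)
    moreover have "y' - x0 \<in> D"
      using 2 assms D[of "y - x0" "r' / r"] by (simp add: y'_def)
    moreover have "y' \<noteq> x0"
      using \<open>dist x0 y' = r'\<close> assms by auto
    moreover have "0 \<le> t * r / r'"
      using 2 assms by simp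
    ultimately show ?thesis
      unfolding cone_from_def by auto
  qed (simp add: cone_from_def)
qed

text \<open>Tangent cones are read off the unit sphere, spherical territories off the sphere of
  radius \<open>r\<close>. A cone remembers only directions, so the two agree for scale-invariant
  \<open>D\<close>.\<close>

lemma cone_from_sphere_radius:
  fixes x0 :: "'a::real_normed_vector"
  assumes "0 < r" "0 < r'" and "\<And>u c. u \<in> D \<Longrightarrow> 0 < c \<Longrightarrow> c *\<^sub>R u \<in> D"
  shows "cone_from x0 {x \<in> sphere x0 r. x - x0 \<in> D} = cone_from x0 {x \<in> sphere x0 r'. x - x0 \<in> D}"
  using cone_from_sphere_subset[of r r' D x0] cone_from_sphere_subset[of r' r D x0] assms by blast

text \<open>The arccosine is decreasing and all radius vectors have length \<open>r\<close>, so
  comparing angles is comparing inner products in reverse.\<close>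

lemma sphere_dist_le_iff:
  assumes "0 < r" "x \<in> sphere x0 r" "p \<in> sphere x0 r" "q \<in> sphere x0 r"
  shows "sphere_dist x0 r x p \<le> sphere_dist x0 r x q \<longleftrightarrow> (x - x0) \<bullet> (q - x0) \<le> (x - x0) \<bullet> (p - x0)"
proof -
  have "sgn (x - x0) \<bullet> sgn (y - x0) = ((x - x0) \<bullet> (y - x0)) / r\<^sup>2" if "y \<in> sphere x0 r" for y
  proof -
    have "norm (x - x0) = r" "norm (y - x0) = r"
      using assms that by (auto simp: dist_norm norm_minus_commute)
    then show ?thesis
      by (simp add: sgn_div_norm power2_eq_square divide_simps)
  qed
  moreover have "sphere_dist x0 r x p \<le> sphere_dist x0 r x q \<longleftrightarrow>
      sgn (x - x0) \<bullet> sgn (q - x0) \<le> sgn (x - x0) \<bullet> sgn (p - x0)"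
    unfolding sphere_dist_def using assms(1) by (simp add: arccos_le_mono abs_inner_sgn_le_1)
  ultimately show ?thesis
    using assms by (simp add: divide_le_cancel)
qed

text \<open>Strict Cauchy-Schwarz for distinct vectors of equal length, obtained by expanding the
  positive square norm of their difference.\<close>

lemma inner_less_of_sphere:
  assumes "p \<in> sphere x0 r" "q \<in> sphere x0 r" "p \<noteq> q"
  shows "(p - x0) \<bullet> (q - x0) < (p - x0) \<bullet> (p - x0)"
proof -
  have "0 < ((p - x0) - (q - x0)) \<bullet> ((p - x0) - (q - x0))"
    using assms by simp
  moreover have "(p - x0) \<bullet> (p - x0) = (q - x0) \<bullet> (q - x0)"
    using assms by (simp add: dot_square_norm dist_norm norm_minus_commute)
  ultimately show ?thesis
    by (simp only: inner_diff_left[of "p - x0" "q - x0"] inner_diff_right[of _ "p - x0" "q - x0"]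
        inner_commute[of "q - x0" "p - x0"])
qed

text \<open>Normalising a nonzero \<open>a\<close> moves it by the difference of
  \<open>norm a\<close> and 1, which is again at most \<open>norm (a - u)\<close>; the triangle
  inequality adds the two errors.\<close>

lemma dist_sgn_le:
  assumes "norm u = 1" "norm (a - u) \<le> d"
  shows "dist u (sgn a) \<le> 2 * d"
proof (cases "a = 0")
  case True
  with assms show ?thesis by (simp add: dist_norm)
next
  case False
  have "a - sgn a = (norm a - 1) *\<^sub>R sgn a"
    using False by (simp add: sgn_div_norm algebra_simps)
  then have "norm (a - sgn a) = \<bar>norm a - 1\<bar>"
    using False by (simp add: norm_sgn)
  also have "\<dots> \<le> norm (a - u)"
    using assms norm_triangle_ineq3[of a u] by simp
  finally have "norm (a - sgn a) \<le> d"
    using assms by simp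
  then show ?thesis
    using assms norm_triangle_ineq[of "u - a" "a - sgn a"] by (simp add: dist_norm norm_minus_commute)
qed

section \<open>Limiting directions of Euclidean territories\<close>

text \<open>\<open>radius_le\<close> and \<open>contact\<close> together make \<open>r\<close> the
  least distance from \<open>x0\<close> to the family, attained by some member; other members may
  have no contact point.\<close>

locale nearest_contact =
  fixes k :: nat and X :: "nat \<Rightarrow> 'a::euclidean_space set" and x0 :: 'a and r :: real
  assumes nonempty: "\<And>i. i \<in> {1..k} \<Longrightarrow> X i \<noteq> {}"
    and closed: "\<And>i. i \<in> {1..k} \<Longrightarrow> closed (X i)"
    and disjoint: "\<And>i j. i \<in> {1..k} \<Longrightarrow> j \<in> {1..k} \<Longrightarrow> i \<noteq> j \<Longrightarrow> X i \<inter> X j = {}"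
    and radius_pos: "0 < r"
    and radius_le: "\<And>i p. i \<in> {1..k} \<Longrightarrow> p \<in> X i \<Longrightarrow> r \<le> dist x0 p"
    and contact: "\<exists>i\<in>{1..k}. X i \<inter> sphere x0 r \<noteq> {}"
begin

abbreviation "ter \<equiv> territory euclidean_metric k X"
abbreviation "X' \<equiv> \<lambda>i. X i \<inter> sphere x0 r"

text \<open>
  To first order, \<open>d(x0 + t u, X i)\<close> is \<open>r - t max u \<bullet> (p - x0) / r\<close> over \<open>p \<in> X' i\<close>.
\<close>

definition dir :: "nat \<Rightarrow> 'a set" where
  "dir i = {u. \<exists>p\<in>X' i. \<forall>j\<in>{1..k}. \<forall>q\<in>X' j. u \<bullet> (q - x0) \<le> u \<bullet> (p - x0)}"

lemma dir_scale: "u \<in> dir i \<Longrightarrow> 0 < c \<Longrightarrow> c *\<^sub>R u \<in> dir i"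
  unfolding dir_def by (auto intro!: bexI mult_left_mono)

lemma ter_iff:
  assumes "i \<in> {1..k}"
  shows "x \<in> ter i \<longleftrightarrow> (\<forall>j\<in>{1..k}. infdist x (X i) \<le> infdist x (X j))"
  using assms nonempty by (auto simp: territory_def mdist_set_euclidean infdist_nonneg)

lemma closed_ter:
  assumes "i \<in> {1..k}"
  shows "closed (ter i)"
proof -
  have "ter i = (\<Inter>j\<in>{1..k}. {x. infdist x (X i) \<le> infdist x (X j)})"
    using assms by (auto simp: ter_iff)
  then show ?thesis
    by (auto intro!: closed_INT closed_Collect_le continuous_intros)
qed

text \<open>Finitely many distances have a minimum. That the territories cover the space turns
  avoiding all the others into membership in the remaining one.\<close>

lemma ex_ter: "\<exists>i\<in>{1..k}. x \<in> ter i"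
proof -
  have "{1..k} \<noteq> {}"
    using contact by blast
  then obtain i where "is_arg_min (\<lambda>i. infdist x (X i)) (\<lambda>i. i \<in> {1..k}) i"
    using ex_is_arg_min_if_finite[of "{1..k}"] by blast
  then show ?thesis
    unfolding is_arg_min_linorder by (auto simp: ter_iff intro!: bexI[of _ i])
qed

text \<open>
  If \<open>p\<close> is a point of \<open>X i\<close> nearest to \<open>x0 + t s\<close>, comparing with \<open>q \<in> X' j\<close> and using
  \<open>dist x0 p \<ge> r = dist x0 q\<close> gives \<open>s \<bullet> (q - x0) \<le> s \<bullet> (p - x0)\<close>; then let \<open>t \<rightarrow> 0\<close>.
\<close>

lemma eventually_notin_ter:
  assumes i: "i \<in> {1..k}" and u: "u \<notin> dir i"
  shows "\<forall>\<^sub>F (t, s) in at_right 0 \<times>\<^sub>F nhds u. x0 + t *\<^sub>R s \<notin> ter i"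
proof (rule ccontr)
  assume "\<not> ?thesis"
  then have freq: "\<exists>\<^sub>F z in at_right 0 \<times>\<^sub>F nhds u. x0 + fst z *\<^sub>R snd z \<in> ter i"
    by (simp add: frequently_def case_prod_unfold)
  \<comment> \<open>Frequent occurrence in the product filter gives hits arbitrarily close to its
    centre; \<open>d = 1 / (n + 1)\<close> then produces the two sequences.\<close>
  have "\<exists>t s. 0 < t \<and> t < d \<and> dist s u < d \<and> x0 + t *\<^sub>R s \<in> ter i" if "0 < d" for d
  proof -
    have "\<forall>\<^sub>F z in at_right 0 \<times>\<^sub>F nhds u. (0 < fst z \<and> fst z < d) \<and> dist (snd z) u < d"
      using that
      by (intro eventually_prodI[of "\<lambda>t. 0 < t \<and> t < d" _ "\<lambda>s. dist s u < d"])
         (auto simp: eventually_at_right_field eventually_nhds_metric)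
    from frequently_ex[OF frequently_eventually_conj[OF freq this]] show ?thesis
      by auto
  qed
  then have "\<forall>n. \<exists>t s. 0 < t \<and> t < inverse (real (Suc n)) \<and> dist s u < inverse (real (Suc n)) \<and>
      x0 + t *\<^sub>R s \<in> ter i"
    by simp
  then obtain t s where t: "\<And>n. 0 < t n" "\<And>n. t n < inverse (real (Suc n))"
    and s: "\<And>n. dist (s n) u < inverse (real (Suc n))" and ter: "\<And>n. x0 + t n *\<^sub>R s n \<in> ter i"
    by metis
  have t0: "t \<longlonglongrightarrow> 0"
    by (rule tendsto_sandwich[OF _ _ tendsto_const LIMSEQ_inverse_real_of_nat])
       (intro always_eventually allI less_imp_le t)+
  have "(\<lambda>n. dist (s n) u) \<longlonglongrightarrow> 0"
    by (rule tendsto_sandwich[OF _ _ tendsto_const LIMSEQ_inverse_real_of_nat])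
       (intro always_eventually allI less_imp_le s zero_le_dist)+
  then have su: "s \<longlonglongrightarrow> u"
    using tendsto_dist_iff by blast
  define y where "y n = x0 + t n *\<^sub>R s n" for n
  have yx0: "y \<longlonglongrightarrow> x0"
    unfolding y_def using tendsto_add[OF tendsto_const tendsto_scaleR[OF t0 su], of x0] by simp
  have "\<forall>n. \<exists>p\<in>X i. infdist (y n) (X i) = dist (y n) p"
    using infdist_attains_inf[OF closed[OF i] nonempty[OF i]] by blast
  then obtain p where p: "\<And>n. p n \<in> X i" "\<And>n. infdist (y n) (X i) = dist (y n) (p n)"
    by metis
  have nearer: "dist (y n) (p n) \<le> dist (y n) q" if "j \<in> {1..k}" "q \<in> X j" for n j q
  proof -
    have "infdist (y n) (X i) \<le> infdist (y n) (X j)"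
      using ter[of n] that i by (simp add: ter_iff y_def)
    also have "\<dots> \<le> dist (y n) q"
      using that by (intro infdist_le)
    finally show ?thesis by (simp add: p)
  qed
  have key: "s n \<bullet> (q - x0) \<le> s n \<bullet> (p n - x0)" if "j \<in> {1..k}" "q \<in> X' j" for n j q
  proof -
    \<comment> \<open>The quadratic term \<open>a \<bullet> a\<close> is common to both squared
      distances and cancels, so the comparison is exact at every \<open>n\<close>.\<close>
    have sq: "(dist (x0 + a) b)\<^sup>2 = a \<bullet> a - 2 * (a \<bullet> (b - x0)) + (dist x0 b)\<^sup>2" for a b
      by (simp add: dist_norm power2_norm_eq_inner inner_diff_left inner_diff_right
          inner_add_left inner_add_right inner_commute)
    have "(dist (y n) (p n))\<^sup>2 \<le> (dist (y n) q)\<^sup>2"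
      using nearer that by (intro power_mono) auto
    moreover have "r\<^sup>2 \<le> (dist x0 (p n))\<^sup>2"
      using radius_le[OF i p(1)] radius_pos by (intro power_mono) auto
    ultimately have "t n * (s n \<bullet> (q - x0)) \<le> t n * (s n \<bullet> (p n - x0))"
      using that by (simp add: y_def sq)
    then show ?thesis
      using t(1)[of n] by simp
  qed
  \<comment> \<open>Any contact point controls all nearest points:
    \<open>dist (y n) (p n) \<le> dist (y n) q0\<close>, and the right side tends to
    \<open>r\<close>. This bounds \<open>p\<close> and later puts its limit point \<open>l\<close>
    on the sphere.\<close>
  obtain j0 q0 where q0: "j0 \<in> {1..k}" "q0 \<in> X' j0"
    using contact by blast
  have lim0: "(\<lambda>n. dist (y n) q0) \<longlonglongrightarrow> r"
    using tendsto_dist[OF yx0 tendsto_const, of q0] q0 by simp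
  have "bounded (range p)"
  proof -
    obtain B where B: "\<And>n. dist (y n) q0 \<le> B"
      using convergent_imp_Bseq[OF convergentI[OF lim0]] unfolding Bseq_def by auto
    obtain B' where B': "\<And>n. dist x0 (y n) \<le> B'"
      using convergent_imp_bounded[OF yx0] bounded_any_center[of "range y" x0] by auto
    have "dist x0 (p n) \<le> B' + B" for n
      using dist_triangle[of x0 "p n" "y n"] B[of n] B'[of n] nearer[OF q0(1), of q0 n] q0 by simp
    then show ?thesis
      unfolding bounded_def by blast
  qed
  then obtain l f where f: "strict_mono f" and l: "(p \<circ> f) \<longlonglongrightarrow> l"
    using bounded_imp_convergent_subsequence by blast
  have "l \<in> X i"
    using closed_sequentially[OF closed[OF i] _ l] p(1) by auto
  have "dist x0 l \<le> r"
  proof (rule LIMSEQ_le)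
    show "(\<lambda>n. dist (y (f n)) (p (f n))) \<longlonglongrightarrow> dist x0 l"
      using tendsto_dist[OF LIMSEQ_subseq_LIMSEQ[OF yx0 f] l] by (simp add: o_def)
    show "(\<lambda>n. dist (y (f n)) q0) \<longlonglongrightarrow> r"
      using LIMSEQ_subseq_LIMSEQ[OF lim0 f] by (simp add: o_def)
    show "\<exists>N. \<forall>n\<ge>N. dist (y (f n)) (p (f n)) \<le> dist (y (f n)) q0"
      using nearer q0 by auto
  qed
  then have "l \<in> X' i"
    using radius_le[OF i \<open>l \<in> X i\<close>] \<open>l \<in> X i\<close> by simp
  moreover have "u \<bullet> (q - x0) \<le> u \<bullet> (l - x0)" if "j \<in> {1..k}" "q \<in> X' j" for j q
  proof (rule LIMSEQ_le)
    show "(\<lambda>n. s (f n) \<bullet> (q - x0)) \<longlonglongrightarrow> u \<bullet> (q - x0)"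
      using LIMSEQ_subseq_LIMSEQ[OF su f] by (intro tendsto_intros) (simp add: o_def)
    show "(\<lambda>n. s (f n) \<bullet> (p (f n) - x0)) \<longlonglongrightarrow> u \<bullet> (l - x0)"
      using LIMSEQ_subseq_LIMSEQ[OF su f] l by (intro tendsto_intros) (simp_all add: o_def)
    show "\<exists>N. \<forall>n\<ge>N. s (f n) \<bullet> (q - x0) \<le> s (f n) \<bullet> (p (f n) - x0)"
      using key[OF that] by blast
  qed
  ultimately show False
    using u unfolding dir_def by blast
qed

text \<open>Strictness keeps \<open>u\<close> out of every other \<open>dir j\<close>, so the ray
  eventually avoids all other territories; as the territories cover the space, it lies in
  \<open>ter i\<close>.\<close>

lemma eventually_in_ter:
  assumes p: "p \<in> X' i"
    and strict: "\<And>j q. j \<in> {1..k} \<Longrightarrow> j \<noteq> i \<Longrightarrow> q \<in> X' j \<Longrightarrow> u \<bullet> (q - x0) < u \<bullet> (p - x0)"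
    and i: "i \<in> {1..k}"
  shows "\<forall>\<^sub>F t in at_right 0. x0 + t *\<^sub>R u \<in> ter i"
proof -
  have "\<forall>\<^sub>F t in at_right 0. \<forall>j\<in>{1..k} - {i}. x0 + t *\<^sub>R u \<notin> ter j"
  proof (intro eventually_ball_finite ballI)
    fix j assume j: "j \<in> {1..k} - {i}"
    have "u \<notin> dir j"
    proof
      assume "u \<in> dir j"
      then obtain q where "q \<in> X' j" "u \<bullet> (p - x0) \<le> u \<bullet> (q - x0)"
        using p i unfolding dir_def by blast
      then show False
        using strict[of j q] j by auto
    qed
    then have "\<forall>\<^sub>F (t, s) in at_right 0 \<times>\<^sub>F nhds u. x0 + t *\<^sub>R s \<notin> ter j"
      using j by (intro eventually_notin_ter) auto
    then show "\<forall>\<^sub>F t in at_right 0. x0 + t *\<^sub>R u \<notin> ter j"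
      unfolding eventually_prod_filter
      by (auto dest!: eventually_nhds_x_imp_x elim!: eventually_mono)
  qed auto
  then show ?thesis
    by eventually_elim (use ex_ter in blast)
qed

text \<open>Tilting a direction of \<open>dir i\<close> towards its contact point makes all inequalities strict.\<close>

lemma eventually_tilted_in_ter:
  assumes p: "p \<in> X' i" and i: "i \<in> {1..k}"
    and max: "\<And>j q. j \<in> {1..k} \<Longrightarrow> q \<in> X' j \<Longrightarrow> u \<bullet> (q - x0) \<le> u \<bullet> (p - x0)"
    and d: "0 < d" and nz: "u + d *\<^sub>R (p - x0) \<noteq> 0"
  shows "\<forall>\<^sub>F t in at_right 0. x0 + t *\<^sub>R sgn (u + d *\<^sub>R (p - x0)) \<in> ter i"
proof (rule eventually_in_ter[OF p _ i])
  fix j q assume j: "j \<in> {1..k}" "j \<noteq> i" "q \<in> X' j"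
  \<comment> \<open>Disjointness separates contact points of different members; this is what makes
    the gain from the tilt strict.\<close>
  then have "p \<noteq> q"
    using p i disjoint[of i j] by auto
  then have "(p - x0) \<bullet> (q - x0) < (p - x0) \<bullet> (p - x0)"
    using p j by (intro inner_less_of_sphere[of p x0 r]) auto
  then have "d * ((p - x0) \<bullet> (q - x0)) < d * ((p - x0) \<bullet> (p - x0))"
    using d by simp
  then have "(u + d *\<^sub>R (p - x0)) \<bullet> (q - x0) < (u + d *\<^sub>R (p - x0)) \<bullet> (p - x0)"
    using max[OF j(1,3)] by (simp only: inner_add_left inner_scaleR_left)
  then have "inverse (norm (u + d *\<^sub>R (p - x0))) * ((u + d *\<^sub>R (p - x0)) \<bullet> (q - x0)) <
      inverse (norm (u + d *\<^sub>R (p - x0))) * ((u + d *\<^sub>R (p - x0)) \<bullet> (p - x0))"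
    using nz by (intro mult_strict_left_mono) auto
  then show "sgn (u + d *\<^sub>R (p - x0)) \<bullet> (q - x0) < sgn (u + d *\<^sub>R (p - x0)) \<bullet> (p - x0)"
    unfolding sgn_div_norm inner_scaleR_left .
qed

section \<open>Small tilts and the tangent cones\<close>

text \<open>The perturbation has norm at most \<open>d * r < 1\<close>, so it cannot cancel the unit
  vector \<open>u\<close>, and \<open>dist_sgn_le\<close> doubles the bound. \<open>v\<close> is
  kept general because a whole segment of tilts occurs for conflict directions.\<close>

lemma small_tilt:
  assumes "norm u = 1" "0 < e" "0 < (d::real)" "d * r < 1" "2 * (d * r) < e" "norm v \<le> r"
  shows "u + d *\<^sub>R v \<noteq> 0" "norm (sgn (u + d *\<^sub>R v)) = 1" "dist u (sgn (u + d *\<^sub>R v)) < e"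
proof -
  have le: "norm (d *\<^sub>R v) \<le> d * r"
    using assms by simp
  show nz: "u + d *\<^sub>R v \<noteq> 0"
  proof
    assume "u + d *\<^sub>R v = 0"
    then have "norm u = norm (d *\<^sub>R v)"
      by (metis add_eq_0_iff norm_minus_cancel)
    moreover have "norm (d *\<^sub>R v) < 1"
      using le assms(4) by (rule le_less_trans)
    ultimately show False
      using assms(1) by simp
  qed
  then show "norm (sgn (u + d *\<^sub>R v)) = 1"
    by (simp add: norm_sgn)
  show "dist u (sgn (u + d *\<^sub>R v)) < e"
    using dist_sgn_le[of u "u + d *\<^sub>R v" "d * r"] assms le by simp
qed

lemma ex_small_tilt:
  assumes "0 < (e::real)"
  shows "\<exists>d>0. d * r < 1 \<and> 2 * (d * r) < e"
proof -
  \<comment> \<open>The witness is \<open>d = min 1 e / (4 * r)\<close>, which makes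
    \<open>d * r\<close> small against both 1 and \<open>e\<close>.\<close>
  have "min 1 e / (4 * r) * r = min 1 e / 4"
    using radius_pos by simp
  moreover have "0 < min 1 e / (4 * r)" "min 1 e / 4 < 1" "2 * (min 1 e / 4) < e"
    using assms radius_pos by auto
  ultimately show ?thesis
    by metis
qed

text \<open>A ray along a direction of \<open>dir i\<close> may itself leave \<open>ter i\<close>
  when another member ties to first order; tilted directions arbitrarily close to it stay inside for
  small radii.\<close>

lemma tangent_cone_ter:
  assumes i: "i \<in> {1..k}"
  shows "tangent_cone x0 (ter i) = cone_from x0 {x \<in> sphere x0 r. x - x0 \<in> dir i}"
proof -
  have "tangent_cone x0 (ter i) = cone_from x0 {x \<in> sphere x0 1. x - x0 \<in> dir i}"
  proof (rule tangent_cone_eqI)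
    show "\<forall>\<^sub>F (t, s) in at_right 0 \<times>\<^sub>F nhds u. x0 + t *\<^sub>R s \<notin> ter i" if "u \<notin> dir i" for u
      using eventually_notin_ter[OF i that] .
  next
    fix u and e :: real assume u: "norm u = 1" "u \<in> dir i" and e: "0 < e"
    from u obtain p where p: "p \<in> X' i"
      and max: "\<And>j q. j \<in> {1..k} \<Longrightarrow> q \<in> X' j \<Longrightarrow> u \<bullet> (q - x0) \<le> u \<bullet> (p - x0)"
      unfolding dir_def by blast
    obtain d where d: "0 < d" "d * r < 1" "2 * (d * r) < e"
      using ex_small_tilt[OF e] by blast
    have "norm (p - x0) \<le> r"
      using p by (simp add: dist_norm norm_minus_commute)
    note tilt = small_tilt[OF u(1) e d this]
    have "\<forall>\<^sub>F t in at_right 0. x0 + t *\<^sub>R sgn (u + d *\<^sub>R (p - x0)) \<in> ter i"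
      using eventually_tilted_in_ter[OF p i max d(1) tilt(1)] .
    then show "\<forall>\<^sub>F t in at_right 0. \<exists>s. norm s = 1 \<and> dist u s < e \<and> x0 + t *\<^sub>R s \<in> ter i"
      by eventually_elim (use tilt in blast)
  qed
  also have "\<dots> = cone_from x0 {x \<in> sphere x0 r. x - x0 \<in> dir i}"
    using radius_pos dir_scale by (intro cone_from_sphere_radius) auto
  finally show ?thesis .
qed

abbreviation "conflict_dir \<equiv> (\<Union>i\<in>{1..k}. \<Union>j\<in>{1..k} - {i}. dir i \<inter> dir j)"

lemma conflict_iff:
  "x \<in> conflict_set euclidean_metric k X \<longleftrightarrow> (\<exists>i\<in>{1..k}. \<exists>j\<in>{1..k} - {i}. x \<in> ter i \<and> x \<in> ter j)"
  unfolding conflict_set_def by auto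

text \<open>A tilt towards a single contact point breaks the tie between the two members, so the
  approximating direction is an intermediate tilt, depending on \<open>t\<close> and found by
  connectedness.\<close>

lemma tangent_cone_conflict:
  "tangent_cone x0 (conflict_set euclidean_metric k X) =
    cone_from x0 {x \<in> sphere x0 r. x - x0 \<in> conflict_dir}"
proof -
  have "tangent_cone x0 (conflict_set euclidean_metric k X) =
      cone_from x0 {x \<in> sphere x0 1. x - x0 \<in> conflict_dir}"
  proof (rule tangent_cone_eqI)
    fix u assume u: "u \<notin> conflict_dir"
    have "\<forall>\<^sub>F z in at_right 0 \<times>\<^sub>F nhds u. \<forall>i\<in>{1..k}. \<forall>j\<in>{1..k} - {i}.
        \<not> (x0 + fst z *\<^sub>R snd z \<in> ter i \<and> x0 + fst z *\<^sub>R snd z \<in> ter j)"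
    proof (intro eventually_ball_finite ballI)
      \<comment> \<open>Outside \<open>conflict_dir\<close>, one direction set of each pair misses
        \<open>u\<close>, and the corresponding territory is eventually avoided; there are only
        finitely many pairs.\<close>
      fix i j assume ij: "i \<in> {1..k}" "j \<in> {1..k} - {i}"
      then consider "u \<notin> dir i" | "u \<notin> dir j"
        using u by blast
      then show "\<forall>\<^sub>F z in at_right 0 \<times>\<^sub>F nhds u.
          \<not> (x0 + fst z *\<^sub>R snd z \<in> ter i \<and> x0 + fst z *\<^sub>R snd z \<in> ter j)"
      proof cases
        case 1
        from eventually_notin_ter[OF ij(1) this] show ?thesis
          by (rule eventually_mono) auto
      next
        case 2
        have "j \<in> {1..k}" using ij by blast
        from eventually_notin_ter[OF this 2] show ?thesis
          by (rule eventually_mono) auto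
      qed
    qed auto
    then show "\<forall>\<^sub>F (t, s) in at_right 0 \<times>\<^sub>F nhds u. x0 + t *\<^sub>R s \<notin> conflict_set euclidean_metric k X"
      by (rule eventually_mono) (auto simp: conflict_iff)
  next
    fix u and e :: real assume u: "norm u = 1" "u \<in> conflict_dir" and e: "0 < e"
    from u obtain i j where ij: "i \<in> {1..k}" "j \<in> {1..k}" "i \<noteq> j" "u \<in> dir i" "u \<in> dir j"
      by blast
    obtain p where p: "p \<in> X' i"
      and maxp: "\<And>j q. j \<in> {1..k} \<Longrightarrow> q \<in> X' j \<Longrightarrow> u \<bullet> (q - x0) \<le> u \<bullet> (p - x0)"
      using ij(4) unfolding dir_def by blast
    obtain q where q: "q \<in> X' j"
      and maxq: "\<And>j' q'. j' \<in> {1..k} \<Longrightarrow> q' \<in> X' j' \<Longrightarrow> u \<bullet> (q' - x0) \<le> u \<bullet> (q - x0)"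
      using ij(5) unfolding dir_def by blast
    obtain d where d: "0 < d" "d * r < 1" "2 * (d * r) < e"
      using ex_small_tilt[OF e] by blast
    have p': "p - x0 \<in> cball 0 r" and q': "q - x0 \<in> cball 0 r"
      using p q by (auto simp: dist_norm norm_minus_commute)
    let ?S = "closed_segment (p - x0) (q - x0)"
    \<comment> \<open>Convexity of the ball bounds the whole segment by \<open>r\<close>, so every
      tilt along it stays within \<open>e\<close> of \<open>u\<close>, uniformly in
      \<open>t\<close>.\<close>
    have seg: "norm v \<le> r" if "v \<in> ?S" for v
      using closed_segment_subset[OF p' q' convex_cball] that by auto
    note tilt = small_tilt[OF u(1) e d seg]
    have "\<forall>\<^sub>F t in at_right 0. x0 + t *\<^sub>R sgn (u + d *\<^sub>R (p - x0)) \<in> ter i"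
      using eventually_tilted_in_ter[OF p ij(1) maxp d(1)] tilt(1)[of "p - x0"] by simp
    moreover have "\<forall>\<^sub>F t in at_right 0. x0 + t *\<^sub>R sgn (u + d *\<^sub>R (q - x0)) \<in> ter j"
      using eventually_tilted_in_ter[OF q ij(2) maxq d(1)] tilt(1)[of "q - x0"] by simp
    ultimately show "\<forall>\<^sub>F t in at_right 0.
        \<exists>s. norm s = 1 \<and> dist u s < e \<and> x0 + t *\<^sub>R s \<in> conflict_set euclidean_metric k X"
    proof eventually_elim
      case (elim t)
      define g where "g v = x0 + t *\<^sub>R sgn (u + d *\<^sub>R v)" for v
      \<comment> \<open>Setting \<open>ter i\<close> against all the others gives two closed sets
        covering the connected arc. A common point lies in some \<open>ter l\<close> with
        \<open>l \<noteq> i\<close>; \<open>l\<close> need not be \<open>j\<close>.\<close>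
      define R where "R = (\<Union>l\<in>{1..k} - {i}. ter l)"
      have "continuous_on ?S g"
        unfolding g_def sgn_div_norm using tilt(1) by (intro continuous_intros) auto
      then have conn: "connected (g ` ?S)"
        by (intro connected_continuous_image connected_segment)
      have "closed R"
        unfolding R_def using closed_ter by (intro closed_UN) auto
      have "g (p - x0) \<in> ter i \<inter> g ` ?S"
        using elim(1) by (auto simp: g_def)
      moreover have "g (q - x0) \<in> R \<inter> g ` ?S"
        using elim(2) ij by (auto simp: g_def R_def)
      moreover have "g ` ?S \<subseteq> ter i \<union> R"
        using ex_ter unfolding R_def by blast
      ultimately have "ter i \<inter> R \<inter> g ` ?S \<noteq> {}"
        using conn closed_ter[OF ij(1)] \<open>closed R\<close> unfolding connected_closed by blast
      then obtain v where v: "v \<in> ?S" "g v \<in> ter i" "g v \<in> R"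
        by blast
      then have "g v \<in> conflict_set euclidean_metric k X"
        using ij(1) unfolding conflict_iff R_def by blast
      then show ?case
        using tilt(2,3)[OF v(1)] unfolding g_def by blast
    qed
  qed
  also have "\<dots> = cone_from x0 {x \<in> sphere x0 r. x - x0 \<in> conflict_dir}"
  proof (rule cone_from_sphere_radius)
    show "c *\<^sub>R u \<in> conflict_dir" if "u \<in> conflict_dir" "0 < c" for u c
      using that dir_scale by blast
  qed (use radius_pos in auto)
  finally show ?thesis .
qed

section \<open>Territories and conflict set on the sphere\<close>

text \<open>By \<open>sphere_dist_le_iff\<close>, geodesic comparison on the sphere is the
  comparison of inner products in \<open>dir\<close>. An empty \<open>X' i\<close> makes both sides
  empty; an empty \<open>X' j\<close> is infinitely far and constrains neither.\<close>

lemma territory_sphere: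
  assumes i: "i \<in> {1..k}"
  shows "territory (sphere_metric x0 r) k X' i = {x \<in> sphere x0 r. x - x0 \<in> dir i}"
proof -
  have "(X' i \<noteq> {} \<and> (\<forall>j\<in>{1..k}. mdist_set (sphere_metric x0 r) x (X' i) \<le>
      mdist_set (sphere_metric x0 r) x (X' j))) \<longleftrightarrow> x - x0 \<in> dir i" (is "?l \<longleftrightarrow> ?r")
    if x: "x \<in> sphere x0 r" for x
  proof
    have le: "ennreal (mdist (sphere_metric x0 r) x p) \<le> ennreal (mdist (sphere_metric x0 r) x q) \<longleftrightarrow>
        (x - x0) \<bullet> (q - x0) \<le> (x - x0) \<bullet> (p - x0)" if "p \<in> X' j" "q \<in> X' l" for p q j l
    proof -
      have "ennreal (mdist (sphere_metric x0 r) x p) \<le> ennreal (mdist (sphere_metric x0 r) x q) \<longleftrightarrow>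
          sphere_dist x0 r x p \<le> sphere_dist x0 r x q"
        using radius_pos mdist_nonneg[of "sphere_metric x0 r" x q] by (simp add: ennreal_le_iff)
      then show ?thesis
        using that x radius_pos sphere_dist_le_iff[of r x x0 p q] by simp
    qed
    show ?r if l: ?l
    proof -
      \<comment> \<open>\<open>dir\<close> demands an actual contact point, whereas the distance is
        an infimum; compactness supplies a point that attains it.\<close>
      have "compact (X' i)"
        using closed[OF i] by (intro closed_Int_compact) auto
      moreover have "continuous_on (X' i) (\<lambda>p. (x - x0) \<bullet> (p - x0))"
        by (intro continuous_intros)
      ultimately obtain p where p: "p \<in> X' i"
        and max: "\<And>b. b \<in> X' i \<Longrightarrow> (x - x0) \<bullet> (b - x0) \<le> (x - x0) \<bullet> (p - x0)"
        using continuous_attains_sup[of "X' i"] l by blast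
      have "(x - x0) \<bullet> (q - x0) \<le> (x - x0) \<bullet> (p - x0)" if q: "j \<in> {1..k}" "q \<in> X' j" for j q
      proof -
        have "ennreal (mdist (sphere_metric x0 r) x p) \<le> mdist_set (sphere_metric x0 r) x (X' i)"
          unfolding mdist_set_def using le[OF p] max by (intro INF_greatest) auto
        also have "\<dots> \<le> mdist_set (sphere_metric x0 r) x (X' j)"
          using l q by blast
        also have "\<dots> \<le> ennreal (mdist (sphere_metric x0 r) x q)"
          unfolding mdist_set_def using q by (intro INF_lower)
        finally show ?thesis
          using le[OF p q(2)] by blast
      qed
      with p show ?thesis
        unfolding dir_def by blast
    qed
    show ?l if r: ?r
    proof -
      obtain p where p: "p \<in> X' i"
        and max: "\<And>j q. j \<in> {1..k} \<Longrightarrow> q \<in> X' j \<Longrightarrow> (x - x0) \<bullet> (q - x0) \<le> (x - x0) \<bullet> (p - x0)"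
        using r unfolding dir_def by blast
      have "mdist_set (sphere_metric x0 r) x (X' i) \<le> mdist_set (sphere_metric x0 r) x (X' j)"
        if j: "j \<in> {1..k}" for j
        unfolding mdist_set_def[of _ _ "X' j"]
      proof (rule INF_greatest)
        fix q assume q: "q \<in> X' j"
        have "mdist_set (sphere_metric x0 r) x (X' i) \<le> ennreal (mdist (sphere_metric x0 r) x p)"
          unfolding mdist_set_def using p by (intro INF_lower)
        also have "\<dots> \<le> ennreal (mdist (sphere_metric x0 r) x q)"
          using le[OF p q] max[OF j q] by blast
        finally show "mdist_set (sphere_metric x0 r) x (X' i) \<le> \<dots>" .
      qed
      with p show ?thesis by blast
    qed
  qed
  moreover have "mspace (sphere_metric x0 r) = sphere x0 r"
    using radius_pos by simp
  ultimately show ?thesis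
    unfolding territory_def by blast
qed

lemma conflict_sphere:
  "conflict_set (sphere_metric x0 r) k X' = {x \<in> sphere x0 r. x - x0 \<in> conflict_dir}"
proof -
  have "mspace (sphere_metric x0 r) = sphere x0 r"
    using radius_pos by simp
  then show ?thesis
    unfolding conflict_set_def using territory_sphere by auto
qed

end

section \<open>Reduction to the contact configuration\<close>

theorem theorem2p2:
  fixes A :: "nat \<Rightarrow> real list set set"
    and k :: nat
    and X X' :: "nat \<Rightarrow> (real ^ 'n) set"
    and x0 :: "real ^ 'n"
    and r0 :: real
  assumes "o_minimal_structure A"
    and "\<And>i. i \<in> {1..k} \<Longrightarrow> X i \<noteq> {}"
    and "\<And>i. i \<in> {1..k} \<Longrightarrow> closed (X i)"
    and "\<And>i. i \<in> {1..k} \<Longrightarrow> definable A (X i)"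
    and "\<And>i j. i \<in> {1..k} \<Longrightarrow> j \<in> {1..k} \<Longrightarrow> i \<noteq> j \<Longrightarrow> X i \<inter> X j = {}"
    and "x0 \<in> conflict_set euclidean_metric k X"
    and "r0 = Min ((\<lambda>i. infdist x0 (X i)) ` {1..k})"
    and "\<And>i. X' i = X i \<inter> sphere x0 r0"
  shows "(\<forall>i\<in>{1..k}. tangent_cone x0 (territory euclidean_metric k X i) =
                     cone_from x0 (territory (sphere_metric x0 r0) k X' i)) \<and>
         tangent_cone x0 (conflict_set euclidean_metric k X) =
         cone_from x0 (conflict_set (sphere_metric x0 r0) k X')"
proof -
  note nonempty = assms(2) and closed = assms(3) and disjoint = assms(5)
    and conflict = assms(6) and r0 = assms(7)
  obtain i j where ij: "i \<in> {1..k}" "j \<in> {1..k}" "i \<noteq> j"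
    and ter: "x0 \<in> territory euclidean_metric k X i" "x0 \<in> territory euclidean_metric k X j"
    using conflict unfolding conflict_set_def by blast
  have min: "infdist x0 (X l) \<le> infdist x0 (X m)"
    if "x0 \<in> territory euclidean_metric k X l" "l \<in> {1..k}" "m \<in> {1..k}" for l m
    using that nonempty by (auto simp: territory_def mdist_set_euclidean infdist_nonneg)
  \<comment> \<open>A member whose territory contains \<open>x0\<close> realises the minimal
    distance; a conflict point provides two such members.\<close>
  have ri: "infdist x0 (X i) = r0" and rj: "infdist x0 (X j) = r0"
    unfolding r0 using min ter ij by (auto intro!: Min_eqI[symmetric])
  \<comment> \<open>Otherwise \<open>x0\<close> would lie in two of the closed sets at once, against
    disjointness.\<close>
  have "0 < r0"
  proof (rule ccontr)
    assume "\<not> 0 < r0"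
    then have "infdist x0 (X i) = 0" "infdist x0 (X j) = 0"
      using ri rj infdist_nonneg[of x0 "X i"] by auto
    then have "x0 \<in> X i \<inter> X j"
      using in_closed_iff_infdist_zero[OF closed nonempty] ij by simp
    then show False
      using disjoint ij by blast
  qed
  interpret nearest_contact k X x0 r0
  proof
    show "r0 \<le> dist x0 p" if "l \<in> {1..k}" "p \<in> X l" for l p
      using min[OF ter(1) ij(1) that(1)] infdist_le[OF that(2), of x0] ri by simp
    obtain p where "p \<in> X i" "infdist x0 (X i) = dist x0 p"
      using infdist_attains_inf[OF closed[OF ij(1)] nonempty[OF ij(1)]] by blast
    then show "\<exists>i\<in>{1..k}. X i \<inter> sphere x0 r0 \<noteq> {}"
      using ij(1) ri by (intro bexI[of _ i]) auto
  qed (use nonempty closed disjoint \<open>0 < r0\<close> in auto)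
  have X': "X' = (\<lambda>i. X i \<inter> sphere x0 r0)"
    using assms(8) by blast
  show ?thesis
    unfolding X' tangent_cone_conflict conflict_sphere
    by (intro conjI ballI refl) (simp only: tangent_cone_ter territory_sphere)
qed

end
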